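(* Let $(P,\cdot,\circ)$ be a finite-dimensional transposed Novikov-Poisson algebra over a field $\mathbf{k}$ with $\operatorname{char}\mathbf{k}\neq 2$. Then $P$ is solvable if and only if both the underlying commutative associative algebra $P_A=(P,\cdot)$ and the underlying Novikov algebra $P_N=(P,\circ)$ are solvable.
   Context: A (left) Novikov algebra $(P,\circ)$ is a vector space with a bilinear operation satisfying $(x\circ y)\circ z=(x\circ z)\circ y$ and $(x\circ y)\circ z-x\circ(y\circ z)=(y\circ x)\circ z-y\circ(x\circ z)$ for all $x,y,z$. A transposed Novikov-Poisson algebra is a triple $(P,\cdot,\circ)$ such that $(P,\cdot)$ is a commutative associative algebra (not necessarily unital), $(P,\circ)$ is a Novikov algebra, and for all $x,y,z\in P$: $(x\cdot y)\circ z=(x\cdot z)\circ y$ and $2z\cdot(x\circ y)=(z\cdot x)\circ y+x\circ(z\cdot y)$. For subspaces $X,Y$ of $P$, $X\cdot Y$ (resp. $X\circ Y$) denotes the linear span of all $x\cdot y$ (resp. $x\circ y$), $x\in X$, $y\in Y$. $P$ is solvable if $P^{(m)}=0$ for some $m\ge 0$, where $P^{(0)}=P$ and $P^{(n+1)}=P^{(n)}\cdot P^{(n)}+P^{(n)}\circ P^{(n)}$. An algebra $(N,* )$ with a single product is solvable if $N^{(m)}=0$ for some $m\ge 0$, where $N^{(0)}=N$ and $N^{(n+1)}=N^{(n)}*N^{(n)}$; this applies to $P_A$ (with $*=\cdot$) and $P_N$ (with $*=\circ$). *)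

theory Defs
  imports Complex_Main "HOL-Library.Set_Algebras"
begin

locale bilinear_algebra = vector_space scale
  for scale :: "'k::field \<Rightarrow> 'p::ab_group_add \<Rightarrow> 'p" +
  fixes mul :: "'p \<Rightarrow> 'p \<Rightarrow> 'p"
  assumes linear_left: "Vector_Spaces.linear scale scale (\<lambda>x. mul x y)"
    and linear_right: "Vector_Spaces.linear scale scale (\<lambda>y. mul x y)"

locale comm_assoc_algebra = bilinear_algebra scale dot
  for scale :: "'k::field \<Rightarrow> 'p::ab_group_add \<Rightarrow> 'p"
    and dot :: "'p \<Rightarrow> 'p \<Rightarrow> 'p" (infixl "\<cdot>" 70) +
  assumes dot_assoc: "(x \<cdot> y) \<cdot> z = x \<cdot> (y \<cdot> z)"
    and dot_commute: "x \<cdot> y = y \<cdot> x"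

locale novikov_algebra = bilinear_algebra scale circ
  for scale :: "'k::field \<Rightarrow> 'p::ab_group_add \<Rightarrow> 'p"
    and circ :: "'p \<Rightarrow> 'p \<Rightarrow> 'p" (infixl "\<odot>" 70) +
  assumes right_commutative: "(x \<odot> y) \<odot> z = (x \<odot> z) \<odot> y"
    and left_symmetric:
      "(x \<odot> y) \<odot> z - x \<odot> (y \<odot> z) = (y \<odot> x) \<odot> z - y \<odot> (x \<odot> z)"

locale transposed_novikov_poisson_algebra =
  A: comm_assoc_algebra scale dot + N: novikov_algebra scale circ
  for scale :: "'k::field \<Rightarrow> 'p::ab_group_add \<Rightarrow> 'p"
    and dot :: "'p \<Rightarrow> 'p \<Rightarrow> 'p" (infixl "\<cdot>" 70)
    and circ :: "'p \<Rightarrow> 'p \<Rightarrow> 'p" (infixl "\<odot>" 70) +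
  assumes dot_circ_swap: "(x \<cdot> y) \<odot> z = (x \<cdot> z) \<odot> y"
    and transposed_leibniz:
      "scale 2 (z \<cdot> (x \<odot> y)) = (z \<cdot> x) \<odot> y + x \<odot> (z \<cdot> y)"

definition finite_dimensional :: "('k::field \<Rightarrow> 'p::ab_group_add \<Rightarrow> 'p) \<Rightarrow> bool" where
  "finite_dimensional scale \<longleftrightarrow> (\<exists>B. finite_dimensional_vector_space scale B)"

definition span_prod ::
  "('k::field \<Rightarrow> 'p::ab_group_add \<Rightarrow> 'p) \<Rightarrow> ('p \<Rightarrow> 'p \<Rightarrow> 'p) \<Rightarrow> 'p set \<Rightarrow> 'p set \<Rightarrow> 'p set" where
  "span_prod scale mul X Y = module.span scale {mul x y | x y. x \<in> X \<and> y \<in> Y}"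

fun derived_series ::
  "('k::field \<Rightarrow> 'p::ab_group_add \<Rightarrow> 'p) \<Rightarrow> ('p \<Rightarrow> 'p \<Rightarrow> 'p) \<Rightarrow> nat \<Rightarrow> 'p set" where
  "derived_series scale mul 0 = UNIV"
| "derived_series scale mul (Suc n) =
     span_prod scale mul (derived_series scale mul n) (derived_series scale mul n)"

definition alg_solvable ::
  "('k::field \<Rightarrow> 'p::ab_group_add \<Rightarrow> 'p) \<Rightarrow> ('p \<Rightarrow> 'p \<Rightarrow> 'p) \<Rightarrow> bool" where
  "alg_solvable scale mul \<longleftrightarrow> (\<exists>m. derived_series scale mul m = {0})"

text \<open>The \<open>+\<close> in the next definition is the elementwise sum of sets from
  \<^theory>\<open>HOL-Library.Set_Algebras\<close>, i.e. the sum of two subspaces.\<close>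

fun tnp_derived_series ::
  "('k::field \<Rightarrow> 'p::ab_group_add \<Rightarrow> 'p) \<Rightarrow> ('p \<Rightarrow> 'p \<Rightarrow> 'p) \<Rightarrow> ('p \<Rightarrow> 'p \<Rightarrow> 'p) \<Rightarrow> nat \<Rightarrow> 'p set" where
  "tnp_derived_series scale dot circ 0 = UNIV"
| "tnp_derived_series scale dot circ (Suc n) =
     span_prod scale dot (tnp_derived_series scale dot circ n) (tnp_derived_series scale dot circ n) +
     span_prod scale circ (tnp_derived_series scale dot circ n) (tnp_derived_series scale dot circ n)"

definition tnp_solvable ::
  "('k::field \<Rightarrow> 'p::ab_group_add \<Rightarrow> 'p) \<Rightarrow> ('p \<Rightarrow> 'p \<Rightarrow> 'p) \<Rightarrow> ('p \<Rightarrow> 'p \<Rightarrow> 'p) \<Rightarrow> bool" where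
  "tnp_solvable scale dot circ \<longleftrightarrow> (\<exists>m. tnp_derived_series scale dot circ m = {0})"

end

theory Submission
  imports Defs
begin

text \<open>
  Write \<open>V\<^sub>b\<close> for the span of all words
  \<open>(\<dots>(x \<odot> y\<^sub>1) \<odot> \<dots>) \<odot> y\<^sub>b\<close>.
  A solvable Novikov algebra satisfies \<open>V\<^sub>K = 0\<close> for some \<open>K\<close>: if words with \<open>K\<close> right factors lie in
  the ideal \<open>I = N\<^bsup>(k)\<^esup>\<close>, then words with \<open>3K + 1\<close> right factors lie in \<open>J = I \<odot> I\<close>,
  because by left symmetry \<open>(i \<odot> y) \<odot> z\<close> and \<open>i \<odot> (y \<odot> z)\<close>, for \<open>i \<in> I\<close>, become equal
  modulo \<open>J\<close> after multiplication by \<open>K\<close> further right factors.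
  Dividing the transposed Leibniz rule by 2 shows that every \<open>V\<^sub>b\<close> is stable under the commutative product,
  so by induction on \<open>j\<close>, \<open>P\<^bsup>(n)\<^esup> \<subseteq> V\<^sub>b\<close> implies
  \<open>P\<^bsup>(n+j)\<^esup> \<subseteq> P\<^sub>A\<^bsup>(j)\<^esup> + V\<^bsub>b+1\<^esub>\<close>.
  If \<open>P\<^sub>A\<^bsup>(m)\<^esup> = 0\<close>, this gives
  \<open>P\<^bsup>(mb)\<^esup> \<subseteq> V\<^sub>b\<close> for all \<open>b\<close>.
\<close>

section \<open>Bilinear products, spans of products and spans of words\<close>

context bilinear_algebra
begin

lemma
  shows mul_add_left: "mul (x + y) z = mul x z + mul y z"
    and mul_add_right: "mul z (x + y) = mul z x + mul z y"
    and mul_scale_left: "mul (scale c x) z = scale c (mul x z)"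
    and mul_scale_right: "mul z (scale c x) = scale c (mul z x)"
    and mul_zero_left: "mul 0 z = 0"
    and mul_zero_right: "mul z 0 = 0"
    and mul_diff_left: "mul (x - y) z = mul x z - mul y z"
proof -
  interpret l: Vector_Spaces.linear scale scale "\<lambda>x. mul x z" by (rule linear_left)
  interpret r: Vector_Spaces.linear scale scale "\<lambda>x. mul z x" by (rule linear_right)
  show "mul (x + y) z = mul x z + mul y z" "mul z (x + y) = mul z x + mul z y"
    "mul (scale c x) z = scale c (mul x z)" "mul z (scale c x) = scale c (mul z x)"
    "mul 0 z = 0" "mul z 0 = 0" "mul (x - y) z = mul x z - mul y z"
    by (simp_all add: l.add r.add l.scale r.scale l.zero r.zero l.diff)
qed

lemma span_prodI: "x \<in> X \<Longrightarrow> y \<in> Y \<Longrightarrow> mul x y \<in> span_prod scale mul X Y"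
  unfolding span_prod_def by (auto intro: span_base)

lemma subspace_span_prod: "subspace (span_prod scale mul X Y)"
  by (simp add: span_prod_def)

lemma span_prod_subsetI:
  assumes "subspace S" "\<And>x y. x \<in> X \<Longrightarrow> y \<in> Y \<Longrightarrow> mul x y \<in> S"
  shows "span_prod scale mul X Y \<subseteq> S"
  unfolding span_prod_def using assms by (intro span_minimal) auto

lemma span_prod_mono:
  "X \<subseteq> X' \<Longrightarrow> Y \<subseteq> Y' \<Longrightarrow> span_prod scale mul X Y \<subseteq> span_prod scale mul X' Y'"
  by (intro span_prod_subsetI subspace_span_prod span_prodI) auto

lemma subspace_derived_series: "subspace (derived_series scale mul n)"
  by (cases n) (simp_all add: subspace_span_prod)

lemma span_mul_left_closed:
  assumes "subspace S" "\<And>g. g \<in> G \<Longrightarrow> mul z g \<in> S" "v \<in> span G"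
  shows "mul z v \<in> S"
  using assms(3)
proof (induction rule: span_induct_alt)
  case base
  show ?case by (simp add: mul_zero_right subspace_0[OF assms(1)])
next
  case (step c g v)
  then show ?case
    by (simp add: mul_add_right mul_scale_right assms subspace_add subspace_scale)
qed

lemma span_mul_right_closed:
  assumes "subspace S" "\<And>g. g \<in> G \<Longrightarrow> mul g z \<in> S" "v \<in> span G"
  shows "mul v z \<in> S"
  using assms(3)
proof (induction rule: span_induct_alt)
  case base
  show ?case by (simp add: mul_zero_left subspace_0[OF assms(1)])
next
  case (step c g v)
  then show ?case
    by (simp add: mul_add_left mul_scale_left assms subspace_add subspace_scale)
qed

lemma foldl_mul_diff: "foldl mul (x - y) zs = foldl mul x zs - foldl mul y zs"
  by (induction zs arbitrary: x y) (simp_all add: mul_diff_left)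

lemma foldl_mul_mem:
  assumes "\<And>x y. x \<in> S \<Longrightarrow> mul x y \<in> S" "x \<in> S"
  shows "foldl mul x zs \<in> S"
  using assms(2) by (induction zs arbitrary: x) (simp_all add: assms(1))

text \<open>This is \<open>V\<^sub>b\<close> of the overview. The index counts right factors, so
  index 0 gives the whole algebra. Spanning by whole words lets a proof split a generator at either
  end.\<close>

definition right_power :: "nat \<Rightarrow> 'p set" where
  "right_power b = span {foldl mul x ys | x ys. length ys = b}"

lemma right_power_0: "right_power 0 = UNIV"
proof -
  have "x \<in> right_power 0" for x
    unfolding right_power_def by (rule span_base) simp
  then show ?thesis by auto
qed

lemma subspace_right_power: "subspace (right_power b)"
  by (simp add: right_power_def)

lemma foldl_mul_right_power: "length ys = b \<Longrightarrow> foldl mul x ys \<in> right_power b"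
  unfolding right_power_def by (auto intro: span_base)

lemma right_power_Suc:
  assumes "v \<in> right_power b"
  shows "mul v y \<in> right_power (Suc b)"
proof -
  have "mul g y \<in> right_power (Suc b)" if "g \<in> {foldl mul x ys | x ys. length ys = b}" for g
  proof -
    from that obtain x ys where "g = foldl mul x ys" "length ys = b" by auto
    then have "mul g y = foldl mul x (ys @ [y])" "length (ys @ [y]) = Suc b" by simp_all
    then show ?thesis using foldl_mul_right_power by metis
  qed
  then show ?thesis
    using span_mul_right_closed[OF subspace_right_power _ assms[unfolded right_power_def]] by blast
qed

end

section \<open>Solvable Novikov algebras are right nilpotent\<close>

context novikov_algebra
begin

text \<open>Right multiplications commute with each other, so \<open>y\<close> can be carried past
  all of \<open>zs\<close>.\<close>

lemma foldl_circ_swap: "foldl (\<odot>) (x \<odot> y) zs = foldl (\<odot>) x zs \<odot> y"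
proof (induction zs arbitrary: x)
  case (Cons z zs)
  then show ?case by (simp add: right_commutative[of x y z])
qed simp

text \<open>Let \<open>I\<close> be the previous term, an ideal by induction, and a, b in
  \<open>I\<close>. Right commutativity turns (a \<odot> b) \<odot> y into (a \<odot> y) \<odot> b,
  and left symmetry writes y \<odot> (a \<odot> b) through (y \<odot> a) \<odot> b, (a \<odot> y)
  \<odot> b and a \<odot> (y \<odot> b). All of these are products of two elements of
  \<open>I\<close>.\<close>

lemma derived_series_ideal:
  "x \<in> derived_series scale circ n \<Longrightarrow>
    x \<odot> y \<in> derived_series scale circ n \<and> y \<odot> x \<in> derived_series scale circ n"
proof (induction n arbitrary: x y)
  case (Suc n)
  let ?I = "derived_series scale circ n" and ?J = "derived_series scale circ (Suc n)"
  have sub: "subspace ?J" by (rule subspace_derived_series)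
  have prod: "a \<odot> b \<in> ?J" if "a \<in> ?I" "b \<in> ?I" for a b
    using that by (simp add: span_prodI)
  have gen: "g \<odot> y \<in> ?J \<and> y \<odot> g \<in> ?J" if "g \<in> {a \<odot> b | a b. a \<in> ?I \<and> b \<in> ?I}" for g
  proof -
    from that obtain a b where g: "g = a \<odot> b" "a \<in> ?I" "b \<in> ?I" by auto
    have "g \<odot> y = (a \<odot> y) \<odot> b" by (simp add: g right_commutative)
    moreover have "y \<odot> g = (y \<odot> a) \<odot> b - (a \<odot> y) \<odot> b + a \<odot> (y \<odot> b)"
      using left_symmetric[of y a b] by (simp add: g algebra_simps)
    moreover have "(a \<odot> y) \<odot> b \<in> ?J" "(y \<odot> a) \<odot> b \<in> ?J" "a \<odot> (y \<odot> b) \<in> ?J"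
      using Suc.IH g by (blast intro: prod)+
    ultimately show ?thesis
      by (simp only: subspace_add[OF sub] subspace_diff[OF sub] simp_thms)
  qed
  have x: "x \<in> span {a \<odot> b | a b. a \<in> ?I \<and> b \<in> ?I}"
    using Suc.prems by (simp add: span_prod_def)
  show ?case
    using span_mul_right_closed[OF sub _ x] span_mul_left_closed[OF sub _ x] gen by blast
qed simp

lemma words_in_derived_series_Suc:
  fixes k
  defines "I \<equiv> derived_series scale circ k" and "J \<equiv> derived_series scale circ (Suc k)"
  assumes words: "\<And>x ys. length ys = K \<Longrightarrow> foldl (\<odot>) x ys \<in> I"
    and len: "length ys = 3 * K + 1"
  shows "foldl (\<odot>) x ys \<in> J"
proof -
  have sub: "subspace J" unfolding J_def by (rule subspace_derived_series)
  have I_right: "a \<odot> b \<in> I" if "a \<in> I" for a b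
    using that derived_series_ideal by (simp add: I_def)
  have J_right: "a \<odot> b \<in> J" if "a \<in> J" for a b
    using that derived_series_ideal unfolding J_def by blast
  have prod: "a \<odot> b \<in> J" if "a \<in> I" "b \<in> I" for a b
    using that by (simp add: I_def J_def span_prodI)
  \<comment> \<open>The length 3K + 1 is K + 1 + K + K: \<open>us\<close> brings the head
    \<open>x\<close> into \<open>I\<close>, \<open>zs\<close> brings \<open>y\<close> into
    \<open>I\<close>, and \<open>ws\<close> supplies the K factors that permit rebracketing.\<close>
  define us y zs ws where "us = take K ys" and "y = ys ! K"
    and "zs = take K (drop (Suc K) ys)" and "ws = drop K (drop (Suc K) ys)"
  have lens: "length us = K" "length zs = K" "length ws = K"
    using len by (simp_all add: us_def zs_def ws_def)
  have ys: "ys = us @ y # zs @ ws"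
    using len id_take_nth_drop[of K ys] by (simp add: us_def y_def zs_def ws_def del: drop_drop)
  define i where "i = foldl (\<odot>) x us"
  have i: "i \<in> I" by (simp add: i_def words lens)
  let ?f = "\<lambda>v. foldl (\<odot>) v ws"
  \<comment> \<open>Left symmetry exchanges \<open>i\<close> and \<open>u\<close> in the associator.
    The factors \<open>ws\<close> can then be moved onto the leading \<open>u\<close>, and
    \<open>?f u\<close> lies in \<open>I\<close>, so both terms have a factor from
    \<open>I \<odot> I\<close>.\<close>
  have step: "?f (i \<odot> u \<odot> z) - ?f (i \<odot> (u \<odot> z)) \<in> J" for u z
  proof -
    have "?f (i \<odot> u \<odot> z) - ?f (i \<odot> (u \<odot> z)) = ?f (u \<odot> i \<odot> z) - ?f (u \<odot> (i \<odot> z))"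
      by (simp add: foldl_mul_diff[symmetric] left_symmetric)
    also have "\<dots> = ?f u \<odot> i \<odot> z - ?f u \<odot> (i \<odot> z)"
      by (simp add: foldl_circ_swap)
    also have "\<dots> \<in> J"
      by (intro subspace_diff[OF sub] J_right prod words lens i I_right)
    finally show ?thesis .
  qed
  \<comment> \<open>Here \<open>zs\<close> is a fresh list of any length. Its factors are absorbed
    one at a time into the right operand of \<open>i\<close>, each at the cost of an element of
    \<open>J\<close>.\<close>
  have congruence: "foldl (\<odot>) (i \<odot> u) (zs @ ws) - ?f (i \<odot> foldl (\<odot>) u zs) \<in> J" for u zs
  proof (induction zs arbitrary: u)
    case Nil
    show ?case by (simp add: subspace_0[OF sub])
  next
    case (Cons z zs)
    \<comment> \<open>Putting \<open>ws\<close> before the remaining factors makes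
      \<open>step\<close> applicable; those factors then keep the difference in
      \<open>J\<close>.\<close>
    have swap: "foldl (\<odot>) v (zs @ ws) = foldl (\<odot>) (?f v) zs" for v
      by (induction zs arbitrary: v) (simp_all add: foldl_circ_swap)
    have "foldl (\<odot>) (i \<odot> u \<odot> z) (zs @ ws) - foldl (\<odot>) (i \<odot> (u \<odot> z)) (zs @ ws) \<in> J"
      unfolding swap foldl_mul_diff[of "?f _", symmetric]
      by (rule foldl_mul_mem[OF J_right step])
    from subspace_add[OF sub this Cons.IH[of "u \<odot> z"]] show ?case by simp
  qed
  have "?f (i \<odot> foldl (\<odot>) y zs) \<in> J"
    by (intro foldl_mul_mem[OF J_right] prod i words lens)
  from subspace_add[OF sub congruence[of y zs] this] show ?thesis
    by (simp add: ys i_def)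
qed

lemma words_in_derived_series:
  "\<exists>K. \<forall>x ys. length ys = K \<longrightarrow> foldl (\<odot>) x ys \<in> derived_series scale circ k"
proof (induction k)
  case (Suc k)
  then obtain K where "\<forall>x ys. length ys = K \<longrightarrow> foldl (\<odot>) x ys \<in> derived_series scale circ k"
    by blast
  then show ?case
    using words_in_derived_series_Suc[of K k] by blast
qed simp

lemma solvable_imp_right_nilpotent:
  assumes "alg_solvable scale circ"
  shows "\<exists>K. right_power K \<subseteq> {0}"
proof -
  obtain m where m: "derived_series scale circ m = {0}"
    using assms by (auto simp: alg_solvable_def)
  obtain K where "\<forall>x ys. length ys = K \<longrightarrow> foldl (\<odot>) x ys \<in> derived_series scale circ m"
    using words_in_derived_series by blast
  then have "right_power K \<subseteq> {0}"
    unfolding right_power_def m by (intro span_minimal) auto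
  then show ?thesis ..
qed

end

section \<open>Interaction of the two products and the solvability criterion\<close>

context transposed_novikov_poisson_algebra
begin

text \<open>Split off the last factor of a word as v \<odot> y. In the Leibniz rule for z \<cdot> (v
  \<odot> y) the left operands z \<cdot> v and v both lie in the span for \<open>b\<close>, the
  first by induction, so one more right factor reaches \<open>Suc b\<close>.\<close>

lemma right_power_dot_closed:
  assumes two: "(2::'k) \<noteq> 0" and "v \<in> N.right_power b"
  shows "z \<cdot> v \<in> N.right_power b"
  using assms(2)
proof (induction b arbitrary: v)
  case 0
  show ?case by (simp add: N.right_power_0)
next
  case (Suc b)
  note sub = N.subspace_right_power
  have gen: "z \<cdot> g \<in> N.right_power (Suc b)"
    if "g \<in> {foldl (\<odot>) x ys | x ys. length ys = Suc b}" for g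
  proof -
    from that obtain x ys where g: "g = foldl (\<odot>) x ys" "length ys = Suc b" by auto
    then obtain us y where ys: "ys = us @ [y]" "length us = b"
      by (metis length_Suc_conv_rev)
    let ?v = "foldl (\<odot>) x us"
    have v: "?v \<in> N.right_power b" using ys by (simp add: N.foldl_mul_right_power)
    have "scale 2 (z \<cdot> g) = (z \<cdot> ?v) \<odot> y + ?v \<odot> (z \<cdot> y)"
      by (simp add: g ys transposed_leibniz)
    also have "\<dots> \<in> N.right_power (Suc b)"
      using Suc.IH[OF v] v by (intro A.subspace_add[OF sub] N.right_power_Suc)
    finally have "scale (1 / 2) (scale 2 (z \<cdot> g)) \<in> N.right_power (Suc b)"
      by (rule A.subspace_scale[OF sub])
    then show ?thesis using two by simp
  qed
  show ?case
    by (rule A.span_mul_left_closed[OF sub gen])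
      (use Suc.prems in \<open>simp_all add: N.right_power_def\<close>)
qed

text \<open>The second inclusion is carried through the induction because it places every
  \<odot>-product of two elements of the current term in
  \<open>N.right_power (Suc b)\<close>.\<close>

lemma tnp_derived_series_subset_plus:
  assumes two: "(2::'k) \<noteq> 0" and "tnp_derived_series scale dot circ n \<subseteq> N.right_power b"
  shows "tnp_derived_series scale dot circ (n + j)
    \<subseteq> derived_series scale dot j + N.right_power (Suc b)
    \<and> tnp_derived_series scale dot circ (n + j) \<subseteq> N.right_power b"
proof (induction j)
  case 0
  have "x \<in> UNIV + N.right_power (Suc b)" for x
    using set_plus_intro[of x UNIV 0] A.subspace_0[OF N.subspace_right_power] by simp
  then show ?case using assms by auto
next
  case (Suc j)
  let ?D = "tnp_derived_series scale dot circ (n + j)"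
  let ?V = "N.right_power (Suc b)" and ?A = "derived_series scale dot"
  have subV: "A.subspace ?V" by (rule N.subspace_right_power)
  have subAV: "A.subspace (?A k + ?V)" for k
  proof -
    have "?A k + ?V = {x + y | x y. x \<in> ?A k \<and> y \<in> ?V}"
      unfolding set_plus_def by blast
    then show ?thesis
      using A.subspace_sums[OF A.subspace_derived_series subV] by simp
  qed
  have dot1: "x \<cdot> y \<in> ?A (Suc j) + ?V" if xy: "x \<in> ?D" "y \<in> ?D" for x y
  proof -
    obtain a v where x: "x = a + v" "a \<in> ?A j" "v \<in> ?V"
      using Suc xy by (blast elim: set_plus_elim)
    obtain a' v' where y: "y = a' + v'" "a' \<in> ?A j" "v' \<in> ?V"
      using Suc xy by (blast elim: set_plus_elim)
    \<comment> \<open>Apart from \<open>a \<cdot> a'\<close>, every term has a factor in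
      \<open>?V\<close>, which absorbs \<cdot>-multiplication.\<close>
    have "x \<cdot> y = a \<cdot> a' + (a \<cdot> v' + y \<cdot> v)"
      by (simp add: x y A.mul_add_left A.mul_add_right A.dot_commute add_ac)
    moreover have "a \<cdot> a' \<in> ?A (Suc j)" using x y by (simp add: A.span_prodI)
    moreover have "a \<cdot> v' + y \<cdot> v \<in> ?V"
      using x y by (intro A.subspace_add[OF subV] right_power_dot_closed two)
    ultimately show ?thesis by (simp add: set_plus_intro del: derived_series.simps)
  qed
  have dot2: "x \<cdot> y \<in> N.right_power b" if "x \<in> ?D" "y \<in> ?D" for x y
    using Suc that right_power_dot_closed[OF two] by blast
  have circ: "x \<odot> y \<in> ?V" if "x \<in> ?D" "y \<in> ?D" for x y
    using Suc that N.right_power_Suc by blast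
  \<comment> \<open>The first right factor is merged into the head of the word.\<close>
  have V_sub: "?V \<subseteq> N.right_power b"
  proof -
    have "foldl (\<odot>) x ys \<in> N.right_power b" if "length ys = Suc b" for x ys
      using that by (cases ys) (auto intro: N.foldl_mul_right_power)
    then show ?thesis
      unfolding N.right_power_def[of "Suc b"]
      by (intro A.span_minimal N.subspace_right_power) auto
  qed
  have V_AV: "?V \<subseteq> ?A (Suc j) + ?V"
    using set_plus_intro[of 0 "?A (Suc j)" _ ?V] A.subspace_0[OF A.subspace_derived_series]
    by (auto simp del: derived_series.simps)
  have d: "span_prod scale dot ?D ?D \<subseteq> ?A (Suc j) + ?V"
      "span_prod scale dot ?D ?D \<subseteq> N.right_power b"
    by (intro A.span_prod_subsetI subAV dot1 dot2 N.subspace_right_power; assumption)+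
  have c: "span_prod scale circ ?D ?D \<subseteq> ?V"
    by (intro N.span_prod_subsetI subV circ)
  have "x + y \<in> ?A (Suc j) + ?V \<and> x + y \<in> N.right_power b"
    if "x \<in> span_prod scale dot ?D ?D" "y \<in> span_prod scale circ ?D ?D" for x y
    using that d c V_AV V_sub
    by (intro conjI A.subspace_add[OF subAV] A.subspace_add[OF N.subspace_right_power]) blast+
  then show ?case
    unfolding add_Suc_right tnp_derived_series.simps by (blast elim: set_plus_elim)
qed

text \<open>Every m steps exhaust the commutative series, leaving only the second summand and so
  gaining one right factor.\<close>

lemma tnp_derived_series_subset_right_power:
  assumes "(2::'k) \<noteq> 0" and "derived_series scale dot m = {0}"
  shows "tnp_derived_series scale dot circ (m * b) \<subseteq> N.right_power b"
proof (induction b)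
  case 0
  show ?case by (simp add: N.right_power_0)
next
  case (Suc b)
  from tnp_derived_series_subset_plus[OF assms(1) this, of m] assms(2)
  have "tnp_derived_series scale dot circ (m * b + m) \<subseteq> N.right_power (Suc b)"
    by (auto elim!: set_plus_elim)
  then show ?case by (simp add: add.commute)
qed

text \<open>Turns an inclusion in {0} into the equality that solvability demands.\<close>

lemma zero_in_tnp_derived_series: "0 \<in> tnp_derived_series scale dot circ n"
proof (cases n)
  case (Suc m)
  then show ?thesis
    using set_plus_intro[OF A.subspace_0[OF A.subspace_span_prod] A.subspace_0[OF N.subspace_span_prod]]
    by simp
qed simp

lemma derived_series_subset_tnp_derived_series:
  "derived_series scale dot n \<subseteq> tnp_derived_series scale dot circ n"
  "derived_series scale circ n \<subseteq> tnp_derived_series scale dot circ n"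
proof (induction n)
  case (Suc n)
  let ?D = "tnp_derived_series scale dot circ n"
  \<comment> \<open>Each summand lies in the sum because the other one contains 0.\<close>
  have "x \<in> span_prod scale dot ?D ?D \<Longrightarrow> x \<in> tnp_derived_series scale dot circ (Suc n)"
    and "x \<in> span_prod scale circ ?D ?D \<Longrightarrow> x \<in> tnp_derived_series scale dot circ (Suc n)" for x
    using set_plus_intro[of x _ 0] set_plus_intro[of 0 _ x]
      A.subspace_0[OF A.subspace_span_prod] A.subspace_0[OF N.subspace_span_prod] by auto
  then show "derived_series scale dot (Suc n) \<subseteq> tnp_derived_series scale dot circ (Suc n)"
    "derived_series scale circ (Suc n) \<subseteq> tnp_derived_series scale dot circ (Suc n)"
    using A.span_prod_mono[OF Suc(1,1)] N.span_prod_mono[OF Suc(2,2)] by auto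
qed simp_all

lemma tnp_solvable_iff:
  assumes "(2::'k) \<noteq> 0"
  shows "tnp_solvable scale dot circ \<longleftrightarrow> alg_solvable scale dot \<and> alg_solvable scale circ"
proof
  assume "tnp_solvable scale dot circ"
  then obtain m where "tnp_derived_series scale dot circ m = {0}"
    by (auto simp: tnp_solvable_def)
  then have "derived_series scale dot m = {0}" "derived_series scale circ m = {0}"
    using derived_series_subset_tnp_derived_series[of m]
      A.subspace_0[OF A.subspace_derived_series] A.subspace_0[OF N.subspace_derived_series]
    by blast+
  then show "alg_solvable scale dot \<and> alg_solvable scale circ"
    by (auto simp: alg_solvable_def)
next
  assume solv: "alg_solvable scale dot \<and> alg_solvable scale circ"
  then obtain m where m: "derived_series scale dot m = {0}"
    by (auto simp: alg_solvable_def)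
  obtain K where "N.right_power K \<subseteq> {0}"
    using solv N.solvable_imp_right_nilpotent by blast
  then have "tnp_derived_series scale dot circ (m * K) = {0}"
    using tnp_derived_series_subset_right_power[OF assms m, of K] zero_in_tnp_derived_series by blast
  then show "tnp_solvable scale dot circ"
    by (auto simp: tnp_solvable_def)
qed

end

theorem theorem3p12:
  fixes scale :: "'k::field \<Rightarrow> 'p::ab_group_add \<Rightarrow> 'p"
    and dot circ :: "'p \<Rightarrow> 'p \<Rightarrow> 'p"
  assumes "transposed_novikov_poisson_algebra scale dot circ"
    and "finite_dimensional scale"
    and "CHAR('k) \<noteq> 2"
  shows "tnp_solvable scale dot circ \<longleftrightarrow> alg_solvable scale dot \<and> alg_solvable scale circ"
proof (rule transposed_novikov_poisson_algebra.tnp_solvable_iff[OF assms(1)])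
  show "(2::'k) \<noteq> 0"
  proof
    assume "(2::'k) = 0"
    \<comment> \<open>A characteristic dividing 2 is 1 or 2, and a field never has characteristic
      1.\<close>
    then have "CHAR('k) dvd 2"
      using of_nat_eq_0_iff_char_dvd[of 2, where ?'a = 'k] by simp
    then have "CHAR('k) \<le> 2" "CHAR('k) \<noteq> 0"
      by (auto dest: dvd_imp_le intro!: Nat.gr0I)
    then show False using CHAR_not_1[where ?'a = 'k] assms(3) by linarith
  qed
qed

end
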